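(* Let $(\mathbb{X},d)$ be a quasi-metric space and let $\emptyset\ne\mathscr{C}\subseteq\mathbb{X}$ be bounded. Put $t^{\ast}:=\big(\overline{\dim}_{\mathrm{M},\exp}(\mathscr{C})\big)^{-1}$. Then: (i) There exists a family $(\mathcal{A}_n^{\ast})_{n\in\mathbb{N}}$ of non-empty subsets of $\mathbb{X}$, of controlled complexity in $\mathbb{X}$, such that for every $0\le t<t^{\ast}$ there exists $C(t)>0$ with $$\sup_{x\in\mathscr{C}}\operatorname{dist}(x,\mathcal{A}_n^{\ast})\le C(t)\cdot n^{-t}\quad\text{for all }n\in\mathbb{N}.$$ (ii) Let $(\mathcal{A}_n)_{n\in\mathbb{N}}$ be a family of controlled complexity in $\mathbb{X}$. If for some $t\ge0$ and some constant $C(t)>0$ we have $\sup_{x\in\mathscr{C}}\operatorname{dist}(x,\mathcal{A}_n)\le C(t)\cdot n^{-t}$ for all $n\in\mathbb{N}$, then $t\le t^{\ast}$. Now set $t^{\sharp}:=\big(\underline{\dim}_{\mathrm{M},\exp}(\mathscr{C})\big)^{-1}$ and assume that $\mu$ is a probability measure on $\mathbb{X}$ that is critical for $\mathscr{C}$. Then: (iii) For every $t>t^{\sharp}$ and every family $(\mathcal{A}_n)_{n\in\mathbb{N}}$ of non-empty subsets of $\mathbb{X}$ of controlled complexity in $\mathbb{X}$, the set $$\mathcal{R}^t\big((\mathcal{A}_n)_{n\in\mathbb{N}},\mathscr{C},\mathbb{X}\big):=\Big\{x\in\mathscr{C}:\ \sup_{n\in\mathbb{N}}\big(n^t\cdot\operatorname{dist}(x,\mathcal{A}_n)\big)<\infty\Big\}$$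 satisfies $\mu^{\ast}\big(\mathcal{R}^t((\mathcal{A}_n)_{n\in\mathbb{N}},\mathscr{C},\mathbb{X})\big)=0$. In fact, even $$\mu^{\ast}\Big(\bigcup_{t\in(t^{\sharp},\infty)}\mathcal{R}^t\big((\mathcal{A}_n)_{n\in\mathbb{N}},\mathscr{C},\mathbb{X}\big)\Big)=0.$$
   Context: Quasi-metric. $d:\mathbb{X}\times\mathbb{X}\to[0,\infty)$ satisfies the metric axioms with the triangle inequality replaced by $d(x,z)\le k(d(x,y)+d(y,z))$ for some constant $k\ge1$. Write $B(x,r)=\{y\in\mathbb{X}:d(x,y)\le r\}$ and $\operatorname{dist}(x,\mathcal{A})=\inf_{a\in\mathcal{A}}d(x,a)$. For a measure $\mu$ on a $\sigma$-algebra $\mathcal{F}$ on $\mathbb{X}$ and arbitrary $M\subseteq\mathbb{X}$, $\mu^{\ast}(M):=\inf\{\mu(A):A\in\mathcal{F},A\supseteq M\}$. Covering numbers and Minkowski dimensions. For $\emptyset\ne S\subseteq\mathbb{X}$, $\mathcal{N}(S,\varepsilon)$ is the least $n\in\mathbb{N}$ such that $S$ is covered by $n$ closed balls of radius $\varepsilon$ with centers in $S$ ($\infty$ if there is none); $\mathcal{N}(\emptyset,\varepsilon)=0$. If $\mathscr{C}$ is totally bounded with at least two elements, $\underline{\dim}_{\mathrm{M},\exp}(\mathscr{C})$ and $\overline{\dim}_{\mathrm{M},\exp}(\mathscr{C})$ are the $\liminf$ and $\limsup$ as $\varepsilon\downarrow0$ of $\frac{\log_2\log_2\mathcal{N}(\mathscr{C},\varepsilon)}{\log_2(1/\varepsilon)}$.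 Both are $0$ if $\mathscr{C}$ has fewer than two elements and $\infty$ if $\mathscr{C}$ is not totally bounded. Conventions: $0^{-1}=\infty$, $\infty^{-1}=0$. Controlled complexity. A family $(\mathcal{A}_n)_{n\in\mathbb{N}}$ of sets $\emptyset\ne\mathcal{A}_n\subseteq\mathbb{X}$ is of controlled complexity in $\mathbb{X}$ if for every $\alpha>0$, $x\in\mathbb{X}$ and $R>0$ there exist $n_0\in\mathbb{N}$ and a function $\eta:\mathbb{N}\to[0,\infty)$ such that $\sup_{n\in\mathbb{N}}\frac{\eta(n)}{n^{1+\delta}}<\infty$ for every $\delta>0$, and $\mathcal{N}\big(B(x,R)\cap\mathcal{A}_n,\,n^{-\alpha}\big)\le\exp(\eta(n))$ for all $n\ge n_0$. Criticality. A measure $\mu$ on some $\sigma$-algebra on $\mathbb{X}$ satisfies the small-ball condition with parameter $s\ge 0$ if there are $c,r_0>0$ with $\mu^{\ast}(B(x,r))\le\exp(-c(1/r)^s)$ for all $x\in\mathbb{X}$, $0<r<r_0$. It is critical for $\mathscr{C}$ if $\mu^{\ast}(\mathscr{C})>0$ and it satisfies the small-ball condition with parameter $s$ for every $0<s<\underline{\dim}_{\mathrm{M},\exp}(\mathscr{C})$. *)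

theory Defs
  imports "HOL-Probability.Probability_Measure"
begin

text \<open>
  Quasi-metric spaces are given by a carrier \<open>X\<close> and a function \<open>d\<close>; nothing is required of \<open>d\<close>
  outside \<open>X\<close>. Sequences are indexed by the positive integers: a family \<open>A :: nat \<Rightarrow> 'a set\<close> and
  a function \<open>\<eta> :: nat \<Rightarrow> real\<close> are only ever constrained and used at arguments \<open>n \<ge> 1\<close>.
\<close>

definition quasi_metric_space :: "'a set \<Rightarrow> ('a \<Rightarrow> 'a \<Rightarrow> real) \<Rightarrow> bool" where
  "quasi_metric_space X d \<longleftrightarrow>
     (\<forall>x\<in>X. \<forall>y\<in>X. 0 \<le> d x y) \<and>
     (\<forall>x\<in>X. \<forall>y\<in>X. d x y = 0 \<longleftrightarrow> x = y) \<and>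
     (\<forall>x\<in>X. \<forall>y\<in>X. d x y = d y x) \<and>
     (\<exists>k\<ge>1. \<forall>x\<in>X. \<forall>y\<in>X. \<forall>z\<in>X. d x z \<le> k * (d x y + d y z))"

definition qball :: "'a set \<Rightarrow> ('a \<Rightarrow> 'a \<Rightarrow> real) \<Rightarrow> 'a \<Rightarrow> real \<Rightarrow> 'a set" where
  "qball X d x r = {y \<in> X. d x y \<le> r}"

definition qbounded :: "'a set \<Rightarrow> ('a \<Rightarrow> 'a \<Rightarrow> real) \<Rightarrow> 'a set \<Rightarrow> bool" where
  "qbounded X d S \<longleftrightarrow> (\<exists>x\<in>X. \<exists>R. S \<subseteq> qball X d x R)"

definition qdist :: "('a \<Rightarrow> 'a \<Rightarrow> real) \<Rightarrow> 'a \<Rightarrow> 'a set \<Rightarrow> real" where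
  "qdist d x A = (INF a\<in>A. d x a)"

text \<open>The infimum in \<^typ>\<open>enat\<close> is a minimum, or \<open>\<infinity>\<close> if no finite cover exists.\<close>

definition covering_number :: "'a set \<Rightarrow> ('a \<Rightarrow> 'a \<Rightarrow> real) \<Rightarrow> 'a set \<Rightarrow> real \<Rightarrow> enat" where
  "covering_number X d S \<epsilon> =
     Inf {enat (card F) | F. finite F \<and> F \<subseteq> S \<and> S \<subseteq> (\<Union>c\<in>F. qball X d c \<epsilon>)}"

definition qtotally_bounded :: "'a set \<Rightarrow> ('a \<Rightarrow> 'a \<Rightarrow> real) \<Rightarrow> 'a set \<Rightarrow> bool" where
  "qtotally_bounded X d S \<longleftrightarrow> (\<forall>\<epsilon>>0. covering_number X d S \<epsilon> < \<infinity>)"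

text \<open>
  Used only for totally bounded \<open>S\<close> with at least two elements, where the covering number is
  finite for all \<open>\<epsilon> > 0\<close> and at least \<open>2\<close> for all small \<open>\<epsilon>\<close>, so that \<^const>\<open>the_enat\<close> and the
  iterated logarithm do not meet their junk values in the limit.
\<close>

definition log_log_ratio :: "'a set \<Rightarrow> ('a \<Rightarrow> 'a \<Rightarrow> real) \<Rightarrow> 'a set \<Rightarrow> real \<Rightarrow> ereal" where
  "log_log_ratio X d S \<epsilon> =
     ereal (log 2 (log 2 (real (the_enat (covering_number X d S \<epsilon>)))) / log 2 (1 / \<epsilon>))"

definition lower_exp_minkowski_dim :: "'a set \<Rightarrow> ('a \<Rightarrow> 'a \<Rightarrow> real) \<Rightarrow> 'a set \<Rightarrow> ereal" where
  "lower_exp_minkowski_dim X d S =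
     (if \<not> (\<exists>x\<in>S. \<exists>y\<in>S. x \<noteq> y) then 0
      else if \<not> qtotally_bounded X d S then \<infinity>
      else Liminf (at_right 0) (log_log_ratio X d S))"

definition upper_exp_minkowski_dim :: "'a set \<Rightarrow> ('a \<Rightarrow> 'a \<Rightarrow> real) \<Rightarrow> 'a set \<Rightarrow> ereal" where
  "upper_exp_minkowski_dim X d S =
     (if \<not> (\<exists>x\<in>S. \<exists>y\<in>S. x \<noteq> y) then 0
      else if \<not> qtotally_bounded X d S then \<infinity>
      else Limsup (at_right 0) (log_log_ratio X d S))"

definition controlled_complexity ::
  "'a set \<Rightarrow> ('a \<Rightarrow> 'a \<Rightarrow> real) \<Rightarrow> (nat \<Rightarrow> 'a set) \<Rightarrow> bool" where
  "controlled_complexity X d A \<longleftrightarrow>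
     (\<forall>n\<ge>1. A n \<noteq> {} \<and> A n \<subseteq> X) \<and>
     (\<forall>\<alpha>>0. \<forall>x\<in>X. \<forall>R>0. \<exists>n0\<ge>1. \<exists>\<eta>::nat \<Rightarrow> real.
        (\<forall>n\<ge>1. 0 \<le> \<eta> n) \<and>
        (\<forall>\<delta>>0. (SUP n\<in>{1..}. ereal (\<eta> n / real n powr (1 + \<delta>))) < \<infinity>) \<and>
        (\<forall>n\<ge>n0. ereal_of_enat (covering_number X d (qball X d x R \<inter> A n) (real n powr (-\<alpha>)))
                   \<le> ereal (exp (\<eta> n))))"

text \<open>\<^const>\<open>outer_measure_of\<close> is the outer measure \<open>\<mu>\<^sup>*\<close>, defined for arbitrary sets.\<close>

definition small_ball_condition ::
  "'a set \<Rightarrow> ('a \<Rightarrow> 'a \<Rightarrow> real) \<Rightarrow> 'a measure \<Rightarrow> real \<Rightarrow> bool" where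
  "small_ball_condition X d \<mu> s \<longleftrightarrow>
     (\<exists>c>0. \<exists>r0>0. \<forall>x\<in>X. \<forall>r. 0 < r \<and> r < r0 \<longrightarrow>
        outer_measure_of \<mu> (qball X d x r) \<le> ennreal (exp (- c * (1 / r) powr s)))"

definition critical_measure ::
  "'a set \<Rightarrow> ('a \<Rightarrow> 'a \<Rightarrow> real) \<Rightarrow> 'a set \<Rightarrow> 'a measure \<Rightarrow> bool" where
  "critical_measure X d S \<mu> \<longleftrightarrow>
     outer_measure_of \<mu> S > 0 \<and>
     (\<forall>s. 0 < s \<and> ereal s < lower_exp_minkowski_dim X d S \<longrightarrow> small_ball_condition X d \<mu> s)"

definition approx_rate_set ::
  "('a \<Rightarrow> 'a \<Rightarrow> real) \<Rightarrow> (nat \<Rightarrow> 'a set) \<Rightarrow> 'a set \<Rightarrow> real \<Rightarrow> 'a set" where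
  "approx_rate_set d A S t =
     {x \<in> S. (SUP n\<in>{1..}. ereal (real n powr t * qdist d x (A n))) < \<infinity>}"

end

theory Submission
  imports Defs
begin

text \<open>
  If every point of \<open>S\<close> is within \<open>K n\<^sup>-\<^sup>t\<close> of \<open>A n\<close>, then a cover of the relevant bounded part of \<open>A n\<close>
  by \<open>exp (\<eta> n)\<close> balls of radius \<open>n\<^sup>-\<^sup>t\<close> becomes, after enlarging the radius by a constant factor, a
  cover of \<open>S\<close>. For \<open>S = C\<close> this bounds the covering numbers of \<open>C\<close>, hence its upper dimension by
  \<open>1 / t\<close>. For the part of \<open>C\<close> that is approximated at rate \<open>t\<close> with a given constant, the small-ball
  condition with a parameter \<open>s\<close> such that \<open>t s > 1\<close> makes the total outer measure of the cover tend
  to \<open>0\<close>; countable subadditivity over the constants and over rational rates does the rest.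
  Conversely, taking for \<open>A n\<close> the centres of a nearly optimal cover of \<open>C\<close> by at most \<open>2\<^sup>n\<close> balls
  attains every rate below the reciprocal of the upper dimension.
\<close>

section \<open>Covering numbers with centres in the covered set\<close>

lemma qball_mono: "r \<le> r' \<Longrightarrow> qball X d c r \<subseteq> qball X d c r'"
  by (auto simp: qball_def)

lemma covering_number_le:
  assumes "finite F" "F \<subseteq> S" "S \<subseteq> (\<Union>c\<in>F. qball X d c \<epsilon>)"
  shows "covering_number X d S \<epsilon> \<le> enat (card F)"
  unfolding covering_number_def using assms by (intro Inf_lower CollectI exI[of _ F] conjI refl)

lemma covering_number_attained:
  assumes "covering_number X d S \<epsilon> < \<infinity>"
  obtains F where "finite F" "F \<subseteq> S" "S \<subseteq> (\<Union>c\<in>F. qball X d c \<epsilon>)"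
    "covering_number X d S \<epsilon> = enat (card F)"
proof -
  let ?P = "\<lambda>F. finite F \<and> F \<subseteq> S \<and> S \<subseteq> (\<Union>c\<in>F. qball X d c \<epsilon>)"
  have eq: "covering_number X d S \<epsilon> = Inf {enat (card F) | F. ?P F}"
    by (simp only: covering_number_def)
  have "{enat (card F) | F. ?P F} \<noteq> {}"
  proof
    assume "{enat (card F) | F. ?P F} = {}"
    then have "covering_number X d S \<epsilon> = \<infinity>"
      unfolding eq by (simp only: Inf_enat_def simp_thms if_True)
    then show False
      using assms by simp
  qed
  then obtain n where "n \<in> {enat (card F) | F. ?P F}"
    by (meson ex_in_conv)
  from wellorder_InfI[OF this] show thesis
    unfolding eq[symmetric] using that by (elim CollectE exE conjE)
qed

lemma covering_number_mono:
  assumes "\<epsilon> \<le> \<epsilon>'"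
  shows "covering_number X d S \<epsilon>' \<le> covering_number X d S \<epsilon>"
proof (cases "covering_number X d S \<epsilon> < \<infinity>")
  case True
  then obtain F where F: "finite F" "F \<subseteq> S" "S \<subseteq> (\<Union>c\<in>F. qball X d c \<epsilon>)"
      "covering_number X d S \<epsilon> = enat (card F)"
    by (rule covering_number_attained)
  have "S \<subseteq> (\<Union>c\<in>F. qball X d c \<epsilon>')"
    by (rule order_trans[OF F(3) UN_mono[OF subset_refl qball_mono[OF assms]]])
  then show ?thesis
    using covering_number_le[OF F(1,2)] F(4) by simp
qed auto

text \<open>Splits the bound in \<open>controlled_complexity\<close> into finiteness, which yields
  an actual cover, and a real inequality for its size.\<close>

lemma ereal_of_enat_le_ereal_iff:
  "ereal_of_enat m \<le> ereal r \<longleftrightarrow> m < \<infinity> \<and> real (the_enat m) \<le> r"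
  by (cases m) auto

section \<open>Quasi-metric spaces: distances to sets and changes of centres\<close>

locale quasi_metric =
  fixes X :: "'a set" and d :: "'a \<Rightarrow> 'a \<Rightarrow> real" and k :: real
  assumes nonneg: "x \<in> X \<Longrightarrow> y \<in> X \<Longrightarrow> 0 \<le> d x y"
    and zero_iff: "x \<in> X \<Longrightarrow> y \<in> X \<Longrightarrow> d x y = 0 \<longleftrightarrow> x = y"
    and sym: "x \<in> X \<Longrightarrow> y \<in> X \<Longrightarrow> d x y = d y x"
    and k_ge_1: "1 \<le> k"
    and triangle: "x \<in> X \<Longrightarrow> y \<in> X \<Longrightarrow> z \<in> X \<Longrightarrow> d x z \<le> k * (d x y + d y z)"

text \<open>Fixing one witness \<open>k\<close> of the relaxed triangle inequality lets later radii
  be computed explicitly in terms of it.\<close>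

lemma quasi_metric_spaceE:
  assumes "quasi_metric_space X d"
  obtains k where "quasi_metric X d k"
proof -
  from assms[unfolded quasi_metric_space_def]
  have "\<exists>k\<ge>1. \<forall>x\<in>X. \<forall>y\<in>X. \<forall>z\<in>X. d x z \<le> k * (d x y + d y z)"
    by (elim conjE)
  then obtain k where "1 \<le> k" "\<forall>x\<in>X. \<forall>y\<in>X. \<forall>z\<in>X. d x z \<le> k * (d x y + d y z)"
    by (elim exE conjE)
  then have "quasi_metric X d k"
    using assms unfolding quasi_metric_space_def quasi_metric_def by simp
  then show thesis
    by (rule that)
qed

context quasi_metric
begin

lemma triangle_le:
  assumes "x \<in> X" "y \<in> X" "z \<in> X" "d x y \<le> a" "d y z \<le> b"
  shows "d x z \<le> k * (a + b)"
  using triangle[OF assms(1-3)] mult_left_mono[of "d x y + d y z" "a + b" k] assms k_ge_1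
  by linarith

lemma qdist_le:
  assumes "A \<subseteq> X" "x \<in> X" "a \<in> A"
  shows "qdist d x A \<le> d x a"
  unfolding qdist_def using assms nonneg by (intro cINF_lower bdd_belowI2[of _ 0]) auto

lemma qdist_nonneg:
  assumes "A \<noteq> {}" "A \<subseteq> X" "x \<in> X"
  shows "0 \<le> qdist d x A"
  unfolding qdist_def using assms nonneg by (intro cINF_greatest) auto

lemma qdist_less_attained:
  assumes "A \<noteq> {}" "qdist d x A < r"
  shows "\<exists>a\<in>A. d x a < r"
  using assms cINF_greatest[of A r "d x"] unfolding qdist_def by (force simp: not_less)

lemma covering_number_le_card:
  assumes "finite S" "S \<subseteq> X" "0 \<le> \<epsilon>"
  shows "covering_number X d S \<epsilon> \<le> enat (card S)"
proof (rule covering_number_le[OF assms(1) subset_refl])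
  have "x \<in> qball X d x \<epsilon>" if "x \<in> S" for x
    using that assms zero_iff[of x x] by (auto simp: qball_def subset_iff)
  then show "S \<subseteq> (\<Union>c\<in>S. qball X d c \<epsilon>)"
    by (intro subsetI UN_I)
qed

text \<open>Balls that miss \<open>S\<close> are dropped, and each other ball is recentred at one of
  its points in \<open>S\<close>; two points of a ball of radius \<open>r\<close> are at most k(r +
  r) apart. This is needed because covering numbers only admit centres in the covered set.\<close>

lemma recenter_cover:
  assumes "finite F" "F \<subseteq> X" "S \<subseteq> X" "S \<subseteq> (\<Union>c\<in>F. qball X d c r)"
  obtains G where "finite G" "G \<subseteq> S" "card G \<le> card F" "S \<subseteq> (\<Union>c\<in>G. qball X d c (2 * k * r))"
proof -
  define F' where "F' = {c\<in>F. S \<inter> qball X d c r \<noteq> {}}"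
  define g where "g c = (SOME x. x \<in> S \<inter> qball X d c r)" for c
  have g: "g c \<in> S \<inter> qball X d c r" if "c \<in> F'" for c
    using that unfolding g_def F'_def some_in_eq by simp
  have F': "finite F'" "card F' \<le> card F"
    using assms(1) unfolding F'_def by (auto intro: card_mono)
  show thesis
  proof (rule that[of "g ` F'"])
    show "card (g ` F') \<le> card F"
      using card_image_le[OF F'(1), of g] F'(2) by linarith
    show "S \<subseteq> (\<Union>c\<in>g ` F'. qball X d c (2 * k * r))"
    proof
      fix x assume "x \<in> S"
      then obtain c where c: "c \<in> F" "x \<in> qball X d c r"
        using assms(4) by blast
      then have "c \<in> F'"
        using \<open>x \<in> S\<close> unfolding F'_def by blast
      then have gc: "g c \<in> X" "d c (g c) \<le> r"
        using g[of c] by (auto simp: qball_def)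
      have "d (g c) x \<le> k * (r + r)"
        using c gc assms(2) sym[of c "g c"] by (intro triangle_le[of _ c]) (auto simp: qball_def)
      then have "x \<in> qball X d (g c) (2 * k * r)"
        using c(2) by (simp add: qball_def)
      then show "x \<in> (\<Union>c\<in>g ` F'. qball X d c (2 * k * r))"
        using \<open>c \<in> F'\<close> by blast
    qed
  qed (use F'(1) g in auto)
qed

text \<open>One ball of radius \<open>\<epsilon>\<close> containing both \<open>x\<close> and
  \<open>y\<close> would force d(x,y) to be at most 2k times \<open>\<epsilon>\<close>, which fails
  below the threshold \<open>e\<close>.\<close>

lemma two_le_covering_number:
  assumes "S \<subseteq> X" "x \<in> S" "y \<in> S" "x \<noteq> y"
  shows "\<forall>\<^sub>F \<epsilon> in at_right 0. 2 \<le> covering_number X d S \<epsilon>"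
proof -
  define e where "e = d x y / (2 * k)"
  have "0 < d x y"
    using assms nonneg[of x y] zero_iff[of x y] by (metis less_eq_real_def subsetD)
  then have "0 < e"
    using k_ge_1 unfolding e_def by simp
  have "2 \<le> covering_number X d S \<epsilon>" if "\<epsilon> < e" for \<epsilon>
  proof (rule ccontr)
    assume "\<not> 2 \<le> covering_number X d S \<epsilon>"
    then have less: "covering_number X d S \<epsilon> < 2"
      by simp
    moreover have "(2 :: enat) < \<infinity>"
      by simp
    ultimately have "covering_number X d S \<epsilon> < \<infinity>"
      by (rule less_trans)
    then obtain F where F: "finite F" "F \<subseteq> S" "S \<subseteq> (\<Union>c\<in>F. qball X d c \<epsilon>)"
      "covering_number X d S \<epsilon> = enat (card F)"
      by (rule covering_number_attained)
    have "card F < 2"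
      using less F(4) by (simp add: numeral_eq_enat)
    then have "card F \<le> 1"
      by simp
    obtain c where c: "c \<in> F" "x \<in> qball X d c \<epsilon>"
      using F(3) assms(2) by blast
    obtain c' where c': "c' \<in> F" "y \<in> qball X d c' \<epsilon>"
      using F(3) assms(3) by blast
    have "c' = c"
      using \<open>card F \<le> 1\<close> F(1) c c' by (auto simp: card_le_Suc0_iff_eq)
    have "d x y \<le> k * (\<epsilon> + \<epsilon>)"
      using c c' F(2) assms(1) sym[of c x] unfolding \<open>c' = c\<close>
      by (intro triangle_le[of _ c]) (auto simp: qball_def)
    also have "\<dots> < k * (e + e)"
      using that k_ge_1 by simp
    also have "\<dots> = d x y"
      using k_ge_1 by (simp add: e_def)
    finally show False
      by simp
  qed
  then show ?thesis
    using \<open>0 < e\<close> by (auto simp: eventually_at_right_field intro!: exI[of _ e])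
qed

end

section \<open>Exponential Minkowski dimensions in terms of covering number bounds\<close>

lemma log_log_ratio_le_iff:
  assumes "2 \<le> covering_number X d S \<epsilon>" "covering_number X d S \<epsilon> < \<infinity>" "0 < \<epsilon>" "\<epsilon> < 1"
  shows "log_log_ratio X d S \<epsilon> \<le> ereal s \<longleftrightarrow>
    real (the_enat (covering_number X d S \<epsilon>)) \<le> 2 powr (\<epsilon> powr - s)"
proof -
  obtain N where N: "covering_number X d S \<epsilon> = enat N"
    using assms(2) by auto
  \<comment> \<open>From 2 on, the inner logarithm is positive, so the outer one can be undone by
    exponentiation; \<open>\<epsilon> < 1\<close> likewise makes the denominator positive.\<close>
  with assms(1) have "2 \<le> N"
    by (simp add: numeral_eq_enat)
  then have pos: "0 < log 2 (real N)" "0 < real N"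
    by auto
  have ln: "0 < log 2 (1 / \<epsilon>)"
    using assms by simp
  have "log 2 (log 2 (real N)) / log 2 (1 / \<epsilon>) \<le> s \<longleftrightarrow>
      log 2 (log 2 (real N)) \<le> log 2 (\<epsilon> powr - s)"
  proof -
    have "s * log 2 (1 / \<epsilon>) = log 2 (\<epsilon> powr - s)"
      using assms by (simp add: log_powr log_divide)
    then show ?thesis
      using ln by (simp only: pos_divide_le_eq)
  qed
  also have "\<dots> \<longleftrightarrow> log 2 (real N) \<le> \<epsilon> powr - s"
    using pos assms by simp
  also have "\<dots> \<longleftrightarrow> real N \<le> 2 powr (\<epsilon> powr - s)"
    using pos by (simp add: log_le_iff)
  finally show ?thesis
    by (simp add: log_log_ratio_def N)
qed

context quasi_metric
begin

text \<open>For at least two balls the inner logarithm is at least 1, so the ratio is non-negative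
  for small radii. This excludes negative and minus infinite dimensions whenever reciprocals are
  taken in \<open>ereal\<close>.\<close>

lemma dim_nonneg:
  assumes "S \<subseteq> X"
  shows "0 \<le> lower_exp_minkowski_dim X d S" "0 \<le> upper_exp_minkowski_dim X d S"
proof -
  have "\<forall>\<^sub>F \<epsilon> in at_right 0. 0 \<le> log_log_ratio X d S \<epsilon>"
    if xy: "x \<in> S" "y \<in> S" "x \<noteq> y" and tb: "qtotally_bounded X d S" for x y
    using two_le_covering_number[OF assms xy] eventually_at_right_real[of 0 1, simplified]
  proof eventually_elim
    case (elim \<epsilon>)
    then obtain N where N: "covering_number X d S \<epsilon> = enat N"
      using tb unfolding qtotally_bounded_def by (metis greaterThanLessThan_iff less_infinityE)
    with elim have "2 \<le> N"
      by (simp add: numeral_eq_enat)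
    then have "1 \<le> log 2 (real N)"
      by simp
    then have "0 \<le> log 2 (log 2 (real N))"
      by simp
    then show ?case
      using elim by (simp add: log_log_ratio_def N)
  qed
  then show "0 \<le> lower_exp_minkowski_dim X d S" "0 \<le> upper_exp_minkowski_dim X d S"
    unfolding lower_exp_minkowski_dim_def upper_exp_minkowski_dim_def
    by (auto intro!: Liminf_bounded le_Limsup)
qed

lemma upper_dim_lessD:
  assumes "S \<subseteq> X" "upper_exp_minkowski_dim X d S < ereal s"
  shows "\<forall>\<^sub>F \<epsilon> in at_right 0. covering_number X d S \<epsilon> < \<infinity> \<and>
    real (the_enat (covering_number X d S \<epsilon>)) \<le> 2 powr (\<epsilon> powr - s)"
proof (cases "\<exists>x\<in>S. \<exists>y\<in>S. x \<noteq> y")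
  case True
  then obtain x y where xy: "x \<in> S" "y \<in> S" "x \<noteq> y"
    by blast
  have tb: "qtotally_bounded X d S"
    using assms True unfolding upper_exp_minkowski_dim_def by (auto split: if_splits)
  have "Limsup (at_right 0) (log_log_ratio X d S) < ereal s"
    using assms True tb unfolding upper_exp_minkowski_dim_def by (auto split: if_splits)
  then have "\<forall>\<^sub>F \<epsilon> in at_right 0. log_log_ratio X d S \<epsilon> < ereal s"
    by (rule Limsup_lessD)
  then show ?thesis
    using two_le_covering_number[OF assms(1) xy] eventually_at_right_real[of 0 1, simplified]
  proof eventually_elim
    case (elim \<epsilon>)
    have "covering_number X d S \<epsilon> < \<infinity>"
      using tb elim unfolding qtotally_bounded_def by simp
    moreover have "log_log_ratio X d S \<epsilon> \<le> ereal s"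
      using elim by simp
    ultimately show ?case
      using log_log_ratio_le_iff[of X d S \<epsilon> s] elim by simp
  qed
next
  case False
  \<comment> \<open>With at most one point the dimension is 0 by convention and carries no limit
    information, but the covering number is at most 1, which is below the claimed bound for every
    radius.\<close>
  then have S: "finite S" "card S \<le> 1"
    by (metis finite.simps is_singletonI' is_singleton_def finite.emptyI)
      (use False in \<open>metis One_nat_def card_le_Suc0_iff_eq card.infinite zero_le\<close>)
  have "covering_number X d S \<epsilon> < \<infinity> \<and>
      real (the_enat (covering_number X d S \<epsilon>)) \<le> 2 powr (\<epsilon> powr - s)" if "0 < \<epsilon>" for \<epsilon>
  proof -
    have "covering_number X d S \<epsilon> \<le> enat (card S)"
      using S(1) assms(1) that by (intro covering_number_le_card) auto
    also have "\<dots> \<le> enat 1"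
      using S(2) by simp
    finally have "covering_number X d S \<epsilon> \<le> enat 1" .
    then obtain N where "covering_number X d S \<epsilon> = enat N" "N \<le> 1"
      by (cases "covering_number X d S \<epsilon>") auto
    moreover have "1 \<le> 2 powr (\<epsilon> powr - s)"
      by (intro ge_one_powr_ge_zero) auto
    ultimately show ?thesis
      by (auto intro: order_trans[of _ 1])
  qed
  then show ?thesis
    by (auto simp: eventually_at_filter)
qed

text \<open>For every t > s the factor \<open>M\<close> is absorbed by the vanishing power
  \<open>\<epsilon> powr (t - s)\<close>, so the limit superior is at most t; then t decreases to
  s.\<close>

lemma upper_dim_leI:
  assumes "S \<subseteq> X" "x \<in> S" "y \<in> S" "x \<noteq> y" "0 < M"
    and bound: "\<forall>\<^sub>F \<epsilon> in at_right 0. covering_number X d S \<epsilon> < \<infinity> \<and>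
      real (the_enat (covering_number X d S \<epsilon>)) \<le> exp (M * \<epsilon> powr - s)"
  shows "upper_exp_minkowski_dim X d S \<le> ereal s"
proof -
  have tb: "qtotally_bounded X d S"
    unfolding qtotally_bounded_def
  proof (intro allI impI)
    fix \<epsilon> :: real assume "0 < \<epsilon>"
    \<comment> \<open>The bound speaks of small radii only; finiteness passes to every larger radius
      by monotonicity.\<close>
    have "\<forall>\<^sub>F \<epsilon>' in at_right 0. \<epsilon>' < \<epsilon> \<and> covering_number X d S \<epsilon>' < \<infinity>"
      using bound eventually_at_right_real[OF \<open>0 < \<epsilon>\<close>] by eventually_elim auto
    from eventually_happens'[OF trivial_limit_at_right_real this]
    obtain \<epsilon>' where "\<epsilon>' < \<epsilon>" "covering_number X d S \<epsilon>' < \<infinity>"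
      by (elim exE conjE)
    then show "covering_number X d S \<epsilon> < \<infinity>"
      using covering_number_mono[of \<epsilon>' \<epsilon> X d S] by (meson less_imp_le le_less_trans)
  qed
  have le: "Limsup (at_right 0) (log_log_ratio X d S) \<le> ereal t" if "s < t" for t
  proof (rule Limsup_bounded)
    have "((\<lambda>\<epsilon>. M * \<epsilon> powr (t - s)) \<longlongrightarrow> 0) (at_right 0)"
      using that by (auto intro!: tendsto_eq_intros tendsto_zero_powrI simp: eventually_at_filter)
    \<comment> \<open>The threshold \<open>ln 2\<close> also accounts for the change from base e to
      base 2.\<close>
    then have "\<forall>\<^sub>F \<epsilon> in at_right 0. M * \<epsilon> powr (t - s) < ln 2"
      by (rule order_tendstoD) simp
    then show "\<forall>\<^sub>F \<epsilon> in at_right 0. log_log_ratio X d S \<epsilon> \<le> ereal t"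
      using two_le_covering_number[OF assms(1-4)] bound eventually_at_right_real[of 0 1, simplified]
    proof eventually_elim
      case (elim \<epsilon>)
      have "M * \<epsilon> powr - s = M * \<epsilon> powr (t - s) * \<epsilon> powr - t"
        by (simp add: powr_add[symmetric])
      also have "\<dots> \<le> ln 2 * \<epsilon> powr - t"
        using elim by (intro mult_right_mono) auto
      finally have "exp (M * \<epsilon> powr - s) \<le> 2 powr (\<epsilon> powr - t)"
        by (simp add: powr_def mult.commute)
      then show ?case
        using elim by (subst log_log_ratio_le_iff) auto
    qed
  qed
  have "Limsup (at_right 0) (log_log_ratio X d S) \<le> ereal s"
  proof (rule ereal_le_epsilon2)
    fix e :: real assume "0 < e"
    then show "Limsup (at_right 0) (log_log_ratio X d S) \<le> ereal s + ereal e"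
      using le[of "s + e"] by simp
  qed
  then show ?thesis
    using assms(2-4) tb unfolding upper_exp_minkowski_dim_def by auto
qed

section \<open>Covers obtained from controlled complexity and an approximation rate\<close>

text \<open>Since \<open>S\<close> is bounded and n^(-t) is at most 1, the approximants used for
  points of \<open>S\<close> stay in one ball around \<open>x0\<close>. The complexity condition
  thus applies with a single radius and with exponent \<open>t\<close> in place of alpha. The
  centres lie in \<open>A n\<close>, not necessarily in \<open>S\<close>.\<close>

lemma controlled_cover:
  assumes A: "controlled_complexity X d A"
    and "x0 \<in> X" and S: "S \<subseteq> qball X d x0 R" and "0 \<le> K" "0 < t"
    and rate: "\<And>n x. 1 \<le> n \<Longrightarrow> x \<in> S \<Longrightarrow> qdist d x (A n) \<le> K * real n powr - t"
  obtains L n0 \<eta> where "0 < L" "1 \<le> n0"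
    "\<forall>\<delta>>0. \<exists>M>0. \<forall>n\<ge>1. \<eta> n \<le> M * real n powr (1 + \<delta>)"
    "\<forall>n\<ge>n0. \<exists>F. finite F \<and> F \<subseteq> X \<and> real (card F) \<le> exp (\<eta> n) \<and>
      S \<subseteq> (\<Union>c\<in>F. qball X d c (L * real n powr - t))"
proof -
  \<comment> \<open>The second entry bounds the distance from \<open>x0\<close> to an approximant;
    the maximum with 1 supplies the positivity that the complexity condition requires.\<close>
  define R' where "R' = max 1 (k * (R + (K + 1)))"
  have AX: "A n \<noteq> {}" "A n \<subseteq> X" if "1 \<le> n" for n
    using A that by (auto simp: controlled_complexity_def)
  have "0 < R'"
    unfolding R'_def by simp
  from A[unfolded controlled_complexity_def, THEN conjunct2, THEN spec, THEN mp, OF \<open>0 < t\<close>,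
      THEN bspec, OF \<open>x0 \<in> X\<close>, THEN spec, THEN mp, OF this]
  obtain n0 and \<eta> :: "nat \<Rightarrow> real" where n0: "1 \<le> n0" and "\<forall>n\<ge>1. 0 \<le> \<eta> n"
    and growth: "\<forall>\<delta>>0. (SUP n\<in>{1..}. ereal (\<eta> n / real n powr (1 + \<delta>))) < \<infinity>"
    and cover: "\<forall>n\<ge>n0. ereal_of_enat (covering_number X d (qball X d x0 R' \<inter> A n) (real n powr - t))
        \<le> ereal (exp (\<eta> n))"
    by (elim exE conjE)
  show thesis
  \<comment> \<open>From a centre to an approximant is at most n^(-t), from there to the point less
    than (K + 1) n^(-t); the triangle inequality adds these to k(K + 2) n^(-t).\<close>
  proof (rule that[of "k * (K + 2)" n0 \<eta>])
    show "0 < k * (K + 2)"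
      using k_ge_1 \<open>0 \<le> K\<close> by simp
    show "1 \<le> n0"
      by fact
  next
    show "\<forall>\<delta>>0. \<exists>M>0. \<forall>n\<ge>1. \<eta> n \<le> M * real n powr (1 + \<delta>)"
    proof (intro allI impI)
      fix \<delta> :: real assume "0 < \<delta>"
      from growth[THEN spec, THEN mp, OF this, THEN less_imp_neq]
      obtain M :: nat where M: "(SUP n\<in>{1..}. ereal (\<eta> n / real n powr (1 + \<delta>))) < ereal (real M)"
        unfolding less_PInf_Ex_of_nat by (elim exE)
      have "\<eta> n \<le> max 1 (real M) * real n powr (1 + \<delta>)" if "1 \<le> n" for n
      proof -
        have "ereal (\<eta> n / real n powr (1 + \<delta>)) \<le> ereal (real M)"
          using that by (intro order_trans[OF SUP_upper less_imp_le[OF M]]) auto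
        then have "\<eta> n \<le> real M * real n powr (1 + \<delta>)"
          using that by (simp add: divide_le_eq)
        also have "\<dots> \<le> max 1 (real M) * real n powr (1 + \<delta>)"
          by (intro mult_right_mono) auto
        finally show ?thesis .
      qed
      then show "\<exists>M>0. \<forall>n\<ge>1. \<eta> n \<le> M * real n powr (1 + \<delta>)"
        by (intro exI[of _ "max 1 (real M)"]) auto
    qed
  next
    show "\<forall>n\<ge>n0. \<exists>F. finite F \<and> F \<subseteq> X \<and> real (card F) \<le> exp (\<eta> n) \<and>
        S \<subseteq> (\<Union>c\<in>F. qball X d c (k * (K + 2) * real n powr - t))"
    proof (intro allI impI)
      fix n assume "n0 \<le> n"
      then have "1 \<le> n"
        using n0 by simp
      let ?B = "qball X d x0 R' \<inter> A n"
      have "covering_number X d ?B (real n powr - t) < \<infinity>"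
        and card: "real (the_enat (covering_number X d ?B (real n powr - t))) \<le> exp (\<eta> n)"
        using cover \<open>n0 \<le> n\<close> unfolding ereal_of_enat_le_ereal_iff by auto
      then obtain F where F: "finite F" "F \<subseteq> ?B" "?B \<subseteq> (\<Union>c\<in>F. qball X d c (real n powr - t))"
        "covering_number X d ?B (real n powr - t) = enat (card F)"
        by (metis covering_number_attained)
      have "S \<subseteq> (\<Union>c\<in>F. qball X d c (k * (K + 2) * real n powr - t))"
      proof
        fix x assume "x \<in> S"
        then have x: "x \<in> X" "d x0 x \<le> R"
          using S by (auto simp: qball_def)
        have "0 < real n powr - t"
          using \<open>1 \<le> n\<close> by simp
        \<comment> \<open>The infimum defining \<open>qdist\<close> may not be attained; raising
          \<open>K\<close> to \<open>K + 1\<close> makes the bound strict, so that some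
          \<open>a\<close> satisfies it.\<close>
        then have "qdist d x (A n) < (K + 1) * real n powr - t"
          using rate[OF \<open>1 \<le> n\<close> \<open>x \<in> S\<close>] unfolding distrib_right by linarith
        from qdist_less_attained[OF AX(1)[OF \<open>1 \<le> n\<close>] this]
        obtain a where a: "a \<in> A n" "d x a < (K + 1) * real n powr - t"
          by (elim bexE)
        then have "a \<in> X"
          using AX \<open>1 \<le> n\<close> by blast
        have "real n powr - t \<le> 1"
          using \<open>1 \<le> n\<close> \<open>0 < t\<close>
          by (simp add: powr_minus ge_one_powr_ge_zero inverse_le_1_iff)
        then have "(K + 1) * real n powr - t \<le> K + 1"
          using \<open>0 \<le> K\<close> by (simp add: mult_left_le)
        then have "d x0 a \<le> k * (R + (K + 1))"
          using x a \<open>x0 \<in> X\<close> \<open>a \<in> X\<close> by (intro triangle_le[of _ x]) auto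
        then have "a \<in> ?B"
          using a \<open>a \<in> X\<close> by (auto simp: qball_def R'_def)
        then obtain c where c: "c \<in> F" "d c a \<le> real n powr - t"
          using F(3) by (auto simp: qball_def)
        then have "c \<in> X"
          using F(2) by (auto simp: qball_def)
        have "d c x \<le> k * (real n powr - t + (K + 1) * real n powr - t)"
          using a c x \<open>a \<in> X\<close> \<open>c \<in> X\<close> sym[of a x] by (intro triangle_le[of _ a]) auto
        also have "\<dots> = k * (K + 2) * real n powr - t"
          by (simp add: algebra_simps)
        finally show "x \<in> (\<Union>c\<in>F. qball X d c (k * (K + 2) * real n powr - t))"
          using c x by (auto simp: qball_def)
      qed
      moreover have "F \<subseteq> X"
        using F(2) by (auto simp: qball_def)
      ultimately show "\<exists>F. finite F \<and> F \<subseteq> X \<and> real (card F) \<le> exp (\<eta> n) \<and>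
          S \<subseteq> (\<Union>c\<in>F. qball X d c (k * (K + 2) * real n powr - t))"
        using F card by auto
    qed
  qed
qed

section \<open>A family attaining every rate below the critical one\<close>

text \<open>A finite set is covered by its own points at every radius, and 2^n is at most e^n; hence
  \<open>\<eta> n = n\<close> works for all exponents, centres and radii at once.\<close>

lemma finite_controlled_complexity:
  assumes "\<And>n. F n \<noteq> {}" "\<And>n. F n \<subseteq> X" "\<And>n. finite (F n)" "\<And>n. card (F n) \<le> 2 ^ n"
  shows "controlled_complexity X d F"
  unfolding controlled_complexity_def
proof (intro conjI allI impI)
  fix \<alpha> R :: real
  show "\<forall>x\<in>X. \<forall>R>0. \<exists>n0\<ge>1. \<exists>\<eta>::nat \<Rightarrow> real.
      (\<forall>n\<ge>1. 0 \<le> \<eta> n) \<and>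
      (\<forall>\<delta>>0. (SUP n\<in>{1..}. ereal (\<eta> n / real n powr (1 + \<delta>))) < \<infinity>) \<and>
      (\<forall>n\<ge>n0. ereal_of_enat (covering_number X d (qball X d x R \<inter> F n) (real n powr (-\<alpha>)))
        \<le> ereal (exp (\<eta> n)))"
  proof (intro ballI allI impI exI[of _ 1] exI[of _ real] conjI)
    fix \<delta> :: real assume "0 < \<delta>"
    have "(SUP n\<in>{1..}. ereal (real n / real n powr (1 + \<delta>))) \<le> ereal 1"
    proof (intro SUP_least)
      fix n :: nat assume "n \<in> {1..}"
      then show "ereal (real n / real n powr (1 + \<delta>)) \<le> ereal 1"
        using powr_mono[of 1 "1 + \<delta>" "real n"] \<open>0 < \<delta>\<close> by (simp add: divide_le_eq)
    qed
    then show "(SUP n\<in>{1..}. ereal (real n / real n powr (1 + \<delta>))) < \<infinity>"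
      by (rule le_less_trans) simp
  next
    fix x and R :: real and n :: nat
    assume "1 \<le> n"
    let ?B = "qball X d x R \<inter> F n"
    have "covering_number X d ?B (real n powr - \<alpha>) \<le> enat (card ?B)"
      using assms(3) by (intro covering_number_le_card) (auto simp: qball_def)
    also have "\<dots> \<le> enat (2 ^ n)"
      using card_mono[of "F n" ?B] assms(3)[of n] assms(4)[of n] by simp
    finally have "ereal_of_enat (covering_number X d ?B (real n powr - \<alpha>)) \<le> ereal (2 ^ n)"
      using ereal_of_enat_le_iff[of _ "enat (2 ^ n)"] by simp
    also have "(2 :: real) ^ n \<le> exp 1 ^ n"
      using exp_ge_add_one_self[of 1] by (intro power_mono) auto
    then have "ereal (2 ^ n) \<le> ereal (exp (real n))"
      by (simp add: exp_of_nat_mult[symmetric])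
    finally show "ereal_of_enat (covering_number X d ?B (real n powr (-\<alpha>))) \<le> ereal (exp (real n))" .
  qed auto
qed (use assms in auto)

text \<open>The family must be fixed before \<open>t\<close>, so the radius \<open>e n\<close> is
  chosen nearly minimal among those for which 2^n balls suffice. Given \<open>t\<close>, it is then
  compared with n^(-1/s) for some \<open>s\<close> above the dimension.\<close>

lemma optimal_family:
  assumes "S \<noteq> {}" "x0 \<in> X" and S: "S \<subseteq> qball X d x0 R"
  obtains A where "controlled_complexity X d A"
    "\<And>t. 0 \<le> t \<Longrightarrow> ereal t < inverse (upper_exp_minkowski_dim X d S) \<Longrightarrow>
       \<exists>K>0. \<forall>n\<ge>1. \<forall>x\<in>S. qdist d x (A n) \<le> K * real n powr - t"
proof -
  have SX: "S \<subseteq> X"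
    using S by (auto simp: qball_def)
  \<comment> \<open>Any two points of \<open>S\<close> are at most k(R + R) apart, so one ball of
    radius \<open>r0\<close> covers \<open>S\<close> and every \<open>E n\<close> is
    non-empty.\<close>
  define r0 where "r0 = max 1 (k * (R + R))"
  define E where "E n = {\<epsilon>. 0 < \<epsilon> \<and> covering_number X d S \<epsilon> \<le> enat (2 ^ n)}" for n :: nat
  have r0: "r0 \<in> E n" for n
  proof -
    obtain c where "c \<in> S"
      using assms(1) by blast
    have "x \<in> qball X d c r0" if "x \<in> S" for x
    proof -
      have "x \<in> X" "c \<in> X" "d x0 x \<le> R" "d x0 c \<le> R"
        using S that \<open>c \<in> S\<close> by (auto simp: qball_def)
      then have "d c x \<le> k * (R + R)"
        using sym[of c x0] \<open>x0 \<in> X\<close> by (intro triangle_le[of _ x0]) auto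
      then show ?thesis
        using \<open>x \<in> X\<close> by (simp add: qball_def r0_def)
    qed
    then have "S \<subseteq> (\<Union>c\<in>{c}. qball X d c r0)"
      by auto
    then have "covering_number X d S r0 \<le> enat (card {c})"
      using \<open>c \<in> S\<close> by (intro covering_number_le) auto
    also have "\<dots> \<le> enat (2 ^ n)"
      by simp
    finally show ?thesis
      unfolding E_def r0_def by simp
  qed
  \<comment> \<open>The infimum of \<open>E n\<close> need not be attained and may be \<open>0\<close>; the slack \<open>n\<^sup>-\<^sup>n\<close> decays
    faster than every power.\<close>
  have "\<exists>e\<in>E n. \<forall>\<epsilon>\<in>E n. e \<le> \<epsilon> + real n powr - real n" if "1 \<le> n" for n
  proof -
    have "bdd_below (E n)"
      unfolding E_def by (intro bdd_belowI[of _ 0]) auto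
    moreover have "Inf (E n) < Inf (E n) + real n powr - real n"
      using that by simp
    ultimately obtain e where e: "e \<in> E n" "e < Inf (E n) + real n powr - real n"
      using cInf_less_iff[of "E n"] r0 by blast
    have "e \<le> \<epsilon> + real n powr - real n" if "\<epsilon> \<in> E n" for \<epsilon>
      using e(2) cInf_lower[OF that \<open>bdd_below (E n)\<close>] by simp
    then show ?thesis
      using e(1) by blast
  qed
  then obtain e where e: "\<And>n. 1 \<le> n \<Longrightarrow> e n \<in> E n"
    "\<And>n \<epsilon>. 1 \<le> n \<Longrightarrow> \<epsilon> \<in> E n \<Longrightarrow> e n \<le> \<epsilon> + real n powr - real n"
    by metis
  have "\<exists>F. finite F \<and> F \<subseteq> S \<and> F \<noteq> {} \<and> card F \<le> 2 ^ n \<and>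
      (1 \<le> n \<longrightarrow> S \<subseteq> (\<Union>c\<in>F. qball X d c (e n)))" for n
  proof (cases "1 \<le> n")
    case True
    then have le: "covering_number X d S (e n) \<le> enat (2 ^ n)"
      using e(1) unfolding E_def by auto
    then have "covering_number X d S (e n) < \<infinity>"
      by (rule le_less_trans) simp
    then obtain F where "finite F" "F \<subseteq> S" "S \<subseteq> (\<Union>c\<in>F. qball X d c (e n))"
      "covering_number X d S (e n) = enat (card F)"
      by (rule covering_number_attained)
    then show ?thesis
      using le assms(1) by (intro exI[of _ F]) auto
  next
    \<comment> \<open>At index 0 no cover is demanded, but
      \<open>finite_controlled_complexity\<close> asks for a non-empty set at every index.\<close>
    case False
    obtain c where "c \<in> S"
      using assms(1) by blast
    then show ?thesis
      using False by (intro exI[of _ "{c}"]) auto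
  qed
  then obtain F where F: "\<And>n. finite (F n)" "\<And>n. F n \<subseteq> S" "\<And>n. F n \<noteq> {}"
    "\<And>n. card (F n) \<le> 2 ^ n" "\<And>n. 1 \<le> n \<Longrightarrow> S \<subseteq> (\<Union>c\<in>F n. qball X d c (e n))"
    by metis
  have FX: "F n \<subseteq> X" for n
    using F(2) SX by (rule subset_trans)
  have dist: "qdist d x (F n) \<le> e n" if "1 \<le> n" "x \<in> S" for n x
  proof -
    from subsetD[OF F(5)[OF that(1)] that(2)] obtain c where c: "c \<in> F n" "d c x \<le> e n"
      by (auto simp: qball_def)
    then have "c \<in> X" "x \<in> X"
      using FX[of n] SX that by auto
    then show ?thesis
      using qdist_le[OF FX, of x c n] c sym[of x c] by simp
  qed
  show thesis
  proof (rule that[of F])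
    show "controlled_complexity X d F"
      using F(3) FX F(1,4) by (rule finite_controlled_complexity)
  next
    fix t :: real
    assume t: "0 \<le> t" "ereal t < inverse (upper_exp_minkowski_dim X d S)"
    \<comment> \<open>For t = 0 any positive \<open>s\<close> above the dimension will do, otherwise
      s = 1/t; an infinite dimension has reciprocal 0, leaving no admissible
      \<open>t\<close>.\<close>
    have "\<exists>s>0. upper_exp_minkowski_dim X d S < ereal s \<and> t * s \<le> 1"
    proof (cases "upper_exp_minkowski_dim X d S")
      case (real r)
      then have "0 \<le> r"
        using dim_nonneg(2)[OF SX] by simp
      show ?thesis
      proof (cases "t = 0")
        case True
        then show ?thesis
          using real \<open>0 \<le> r\<close> by (intro exI[of _ "r + 1"]) auto
      next
        case False
        then have "r < 1 / t"
          using t real \<open>0 \<le> r\<close> by (cases "r = 0") (auto simp: field_simps)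
        then show ?thesis
          using t False real by (intro exI[of _ "1 / t"]) auto
      qed
    qed (use t dim_nonneg(2)[OF SX] in auto)
    then obtain s where s: "0 < s" "upper_exp_minkowski_dim X d S < ereal s" "t * s \<le> 1"
      by blast
    obtain b where "0 < b" and b: "\<And>\<epsilon>. 0 < \<epsilon> \<Longrightarrow> \<epsilon> < b \<Longrightarrow> covering_number X d S \<epsilon> < \<infinity> \<and>
        real (the_enat (covering_number X d S \<epsilon>)) \<le> 2 powr (\<epsilon> powr - s)"
      using upper_dim_lessD[OF SX s(2)] by (auto simp: eventually_at_right_field)
    have "((\<lambda>n. real n powr - (1 / s)) \<longlongrightarrow> 0) sequentially"
      using s(1) by (intro tendsto_neg_powr filterlim_real_sequentially) auto
    then have "\<forall>\<^sub>F n in sequentially. real n powr - (1 / s) < b"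
      using \<open>0 < b\<close> by (rule order_tendstoD)
    then obtain n1 where n1: "\<And>n. n1 \<le> n \<Longrightarrow> real n powr - (1 / s) < b"
      by (auto simp: eventually_sequentially)
    \<comment> \<open>From \<open>m\<close> on, the radius n^(-1/s) lies in the range where
      \<open>b\<close> gives the covering bound, and n is at least \<open>t\<close>, so that the
      slack n^(-n) is at most n^(-t).\<close>
    define m where "m = max (max 1 n1) (nat \<lceil>t\<rceil>)"
    have large: "e n \<le> 2 * real n powr - t" if "m \<le> n" for n
    proof -
      have n: "1 \<le> n" "n1 \<le> n" "t \<le> real n"
        using that unfolding m_def by linarith+
      obtain N where N: "covering_number X d S (real n powr - (1 / s)) = enat N"
        "real N \<le> 2 powr ((real n powr - (1 / s)) powr - s)"
        using b[of "real n powr - (1 / s)"] n1 n by auto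
      have "(real n powr - (1 / s)) powr - s = real n"
        using s(1) n by (simp add: powr_powr)
      then have "real N \<le> real (2 ^ n)"
        using N(2) by (simp add: powr_realpow)
      then have "covering_number X d S (real n powr - (1 / s)) \<le> enat (2 ^ n)"
        unfolding of_nat_le_iff N(1) by simp
      then have "e n \<le> real n powr - (1 / s) + real n powr - real n"
        using e(2) n unfolding E_def by simp
      also have "real n powr - (1 / s) \<le> real n powr - t"
        using n s by (intro powr_mono) (auto simp: field_simps)
      also have "real n powr - real n \<le> real n powr - t"
        using n by (intro powr_mono) auto
      finally show ?thesis
        by simp
    qed
    \<comment> \<open>For the finitely many smaller indices the crude bound r0 + 1 suffices, since
      m^t n^(-t) is at least 1 there.\<close>
    have small: "e n \<le> (r0 + 1) * real m powr t * real n powr - t" if "1 \<le> n" "n < m" for n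
    proof -
      have "real n powr - real n \<le> real n powr 0"
        using that by (intro powr_mono) auto
      then have "e n \<le> r0 + 1"
        using e(2)[OF that(1) r0] that by simp
      moreover have "1 \<le> real m powr t * real n powr - t"
        using powr_mono2[of t "real n" "real m"] that t(1)
        by (simp add: powr_minus divide_inverse[symmetric] le_divide_eq)
      moreover have "0 < r0"
        unfolding r0_def by simp
      ultimately have "(r0 + 1) * 1 \<le> (r0 + 1) * (real m powr t * real n powr - t)"
        by (intro mult_left_mono) auto
      then show ?thesis
        using \<open>e n \<le> r0 + 1\<close> unfolding mult.assoc mult_1_right by linarith
    qed
    have "0 < r0"
      unfolding r0_def by simp
    define K where "K = 2 + (r0 + 1) * real m powr t"
    have "qdist d x (F n) \<le> K * real n powr - t" if "1 \<le> n" "x \<in> S" for n x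
    proof -
      have "2 * real n powr - t \<le> K * real n powr - t"
        "(r0 + 1) * real m powr t * real n powr - t \<le> K * real n powr - t"
        using \<open>0 < r0\<close> unfolding K_def by (intro mult_right_mono; simp)+
      then show ?thesis
        using dist[OF that] large[of n] small[of n] that by linarith
    qed
    moreover have "0 < K"
      using \<open>0 < r0\<close> unfolding K_def by (intro add_pos_nonneg) auto
    ultimately show "\<exists>K>0. \<forall>n\<ge>1. \<forall>x\<in>S. qdist d x (F n) \<le> K * real n powr - t"
      by blast
  qed
qed

section \<open>The critical rate as an upper bound\<close>

lemma upper_dim_le_of_rate:
  assumes A: "controlled_complexity X d A"
    and "x0 \<in> X" and S: "S \<subseteq> qball X d x0 R" and "0 \<le> K" "0 < t"
    and rate: "\<And>n x. 1 \<le> n \<Longrightarrow> x \<in> S \<Longrightarrow> qdist d x (A n) \<le> K * real n powr - t"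
    and xy: "x \<in> S" "y \<in> S" "x \<noteq> y"
  shows "upper_exp_minkowski_dim X d S \<le> ereal (1 / t)"
proof (rule ereal_le_epsilon2)
  fix e :: real assume "0 < e"
  \<comment> \<open>Any \<open>s\<close> above 1/t gives s t > 1, so \<open>\<eta>\<close> can be
    bounded by a multiple of n^(s t), with \<open>\<delta>\<close> equal to s t - 1.\<close>
  define s where "s = 1 / t + e"
  have s: "1 < s * t" "0 < s"
    using \<open>0 < e\<close> \<open>0 < t\<close> unfolding s_def by (auto simp: field_simps add_pos_pos)
  have SX: "S \<subseteq> X"
    using S by (auto simp: qball_def)
  obtain L n0 \<eta> where "0 < L" "1 \<le> n0"
    and \<eta>: "\<forall>\<delta>>0. \<exists>M>0. \<forall>n\<ge>1. \<eta> n \<le> M * real n powr (1 + \<delta>)"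
    and cover: "\<forall>n\<ge>n0. \<exists>F. finite F \<and> F \<subseteq> X \<and> real (card F) \<le> exp (\<eta> n) \<and>
      S \<subseteq> (\<Union>c\<in>F. qball X d c (L * real n powr - t))"
    by (rule controlled_cover[OF assms(1-6)])
  obtain M where "0 < M" and M: "\<And>n. 1 \<le> n \<Longrightarrow> \<eta> n \<le> M * real n powr (s * t)"
    using \<eta>[THEN spec, of "s * t - 1"] s by auto
  \<comment> \<open>The factor 2k is the price of moving the centres into \<open>S\<close> by
    \<open>recenter_cover\<close>.\<close>
  define L' where "L' = 2 * k * L"
  have "0 < L'"
    using k_ge_1 \<open>0 < L\<close> unfolding L'_def by simp
  have bound: "covering_number X d S \<epsilon> < \<infinity> \<and>
      real (the_enat (covering_number X d S \<epsilon>)) \<le> exp (M * 2 powr (s * t) * L' powr s * \<epsilon> powr - s)"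
    if \<epsilon>: "0 < \<epsilon>" "\<epsilon> < L' / real n0 powr t" for \<epsilon>
  proof -
    \<comment> \<open>\<open>z\<close> solves L' z^(-t) = \<open>\<epsilon>\<close>. Rounding up
      makes the radius at index \<open>n\<close> at most \<open>\<epsilon>\<close>, while n <= 2z,
      valid as z >= 1, keeps the number of balls under control.\<close>
    define z where "z = (L' / \<epsilon>) powr (1 / t)"
    define n where "n = nat \<lceil>z\<rceil>"
    have "real n0 powr t \<le> L' / \<epsilon>"
      using \<epsilon> \<open>1 \<le> n0\<close> by (simp add: field_simps)
    then have "(real n0 powr t) powr (1 / t) \<le> z"
      using \<open>0 < t\<close> unfolding z_def by (intro powr_mono2) auto
    then have "real n0 \<le> z"
      using \<open>0 < t\<close> by (simp add: powr_powr)
    then have n: "z \<le> real n" "real n \<le> 2 * z" "n0 \<le> n" "1 \<le> z" "1 \<le> n"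
      using \<open>1 \<le> n0\<close> unfolding n_def by linarith+
    have "real n powr - t \<le> z powr - t"
      using n \<open>0 < t\<close> by (intro powr_mono2') auto
    also have "z powr - t = \<epsilon> / L'"
      using \<open>0 < t\<close> \<open>0 < L'\<close> \<epsilon> by (simp add: z_def powr_powr powr_minus_divide)
    finally have radius: "2 * k * (L * real n powr - t) \<le> \<epsilon>"
      using \<open>0 < L'\<close> unfolding L'_def by (simp add: field_simps)
    have "real n powr (s * t) \<le> (2 * z) powr (s * t)"
      using n s by (intro powr_mono2) auto
    also have "\<dots> = 2 powr (s * t) * (L' powr s * \<epsilon> powr - s)"
      using \<open>0 < t\<close> \<open>0 < L'\<close> \<epsilon> n
      by (simp add: powr_mult z_def powr_powr powr_divide powr_minus_divide)
    finally have "M * real n powr (s * t) \<le> M * 2 powr (s * t) * L' powr s * \<epsilon> powr - s"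
      using \<open>0 < M\<close> by (simp add: mult.assoc)
    then have \<eta>n: "\<eta> n \<le> M * 2 powr (s * t) * L' powr s * \<epsilon> powr - s"
      using M[OF n(5)] by linarith
    from cover n(3) have "\<exists>F. finite F \<and> F \<subseteq> X \<and> real (card F) \<le> exp (\<eta> n) \<and>
        S \<subseteq> (\<Union>c\<in>F. qball X d c (L * real n powr - t))"
      by simp
    then obtain F where F: "finite F" "F \<subseteq> X" "real (card F) \<le> exp (\<eta> n)"
      "S \<subseteq> (\<Union>c\<in>F. qball X d c (L * real n powr - t))"
      by (elim exE conjE)
    obtain G where G: "finite G" "G \<subseteq> S" "card G \<le> card F"
      "S \<subseteq> (\<Union>c\<in>G. qball X d c (2 * k * (L * real n powr - t)))"
      using recenter_cover[OF F(1,2) SX F(4)] by blast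
    have "covering_number X d S \<epsilon> \<le> covering_number X d S (2 * k * (L * real n powr - t))"
      using radius by (rule covering_number_mono)
    also have "\<dots> \<le> enat (card G)"
      using G by (intro covering_number_le)
    also have "\<dots> \<le> enat (card F)"
      using G(3) by simp
    finally have "covering_number X d S \<epsilon> \<le> enat (card F)" .
    then obtain N where "covering_number X d S \<epsilon> = enat N" "N \<le> card F"
      by (cases "covering_number X d S \<epsilon>") auto
    moreover from this have "real N \<le> real (card F)"
      by simp
    moreover have "exp (\<eta> n) \<le> exp (M * 2 powr (s * t) * L' powr s * \<epsilon> powr - s)"
      using \<eta>n by simp
    ultimately have "real N \<le> exp (M * 2 powr (s * t) * L' powr s * \<epsilon> powr - s)"
      using F(3) by linarith
    then show ?thesis
      using \<open>covering_number X d S \<epsilon> = enat N\<close> by simp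
  qed
  have "upper_exp_minkowski_dim X d S \<le> ereal s"
  proof (rule upper_dim_leI[OF SX xy])
    show "0 < M * 2 powr (s * t) * L' powr s"
      using \<open>0 < M\<close> \<open>0 < L'\<close> by simp
    have "0 < L' / real n0 powr t"
      using \<open>0 < L'\<close> \<open>1 \<le> n0\<close> by simp
    then show "\<forall>\<^sub>F \<epsilon> in at_right 0. covering_number X d S \<epsilon> < \<infinity> \<and>
        real (the_enat (covering_number X d S \<epsilon>))
          \<le> exp (M * 2 powr (s * t) * L' powr s * \<epsilon> powr - s)"
      unfolding eventually_at_right_field using bound by blast
  qed
  then show "upper_exp_minkowski_dim X d S \<le> ereal (1 / t) + ereal e"
    by (simp add: s_def)
qed

end

section \<open>Outer measure and null sets of well-approximated points\<close>

text \<open>The sets need not be measurable; each is replaced by a measurable superset of the same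
  outer measure, and countable unions of null sets are null.\<close>

lemma outer_measure_of_UN_null:
  fixes A :: "nat \<Rightarrow> 'a set"
  assumes "\<And>i. A i \<subseteq> space M" "\<And>i. outer_measure_of M (A i) = 0"
  shows "outer_measure_of M (\<Union>i. A i) = 0"
proof -
  obtain E where E: "\<And>i. E i \<in> sets M" "\<And>i. A i \<subseteq> E i" "\<And>i. emeasure M (E i) = 0"
    using outer_measure_of_attain[OF assms(1)] assms(2) by metis
  have "(\<Union>i. E i) \<in> null_sets M"
    using E by (intro null_sets_UN) auto
  moreover have "outer_measure_of M (\<Union>i. A i) \<le> outer_measure_of M (\<Union>i. E i)"
    using E(2) by (intro outer_measure_of_mono) blast
  ultimately show ?thesis
    by (auto simp: null_sets_def)
qed

lemma outer_measure_of_finite_UN_le: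
  assumes "finite F" "\<And>c. c \<in> F \<Longrightarrow> A c \<subseteq> space M"
  shows "outer_measure_of M (\<Union>c\<in>F. A c) \<le> (\<Sum>c\<in>F. outer_measure_of M (A c))"
proof -
  obtain E where E: "\<And>c. c \<in> F \<Longrightarrow> E c \<in> sets M" "\<And>c. c \<in> F \<Longrightarrow> A c \<subseteq> E c"
    "\<And>c. c \<in> F \<Longrightarrow> outer_measure_of M (A c) = emeasure M (E c)"
    using outer_measure_of_attain[OF assms(2)] by metis
  have "outer_measure_of M (\<Union>c\<in>F. A c) \<le> outer_measure_of M (\<Union>c\<in>F. E c)"
    using E(2) by (intro outer_measure_of_mono) blast
  also have "\<dots> = emeasure M (\<Union>c\<in>F. E c)"
    using E(1) assms(1) by (intro outer_measure_of_eq sets.finite_UN)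
  also have "\<dots> \<le> (\<Sum>c\<in>F. emeasure M (E c))"
    using E(1) assms(1) by (intro emeasure_subadditive_finite) auto
  finally show ?thesis
    using E(3) by simp
qed

text \<open>Factoring out n^q leaves M n^(-(q - p)) - c, which tends to -c < 0, while n^q tends to
  infinity; so the exponent tends to minus infinity.\<close>

lemma tendsto_exp_powr_diff:
  assumes "p < q" "0 < q" "0 < (c :: real)"
  shows "(\<lambda>n. exp (M * real n powr p - c * real n powr q)) \<longlonglongrightarrow> 0"
proof -
  have "(\<lambda>n. M * real n powr - (q - p) - c) \<longlonglongrightarrow> M * 0 - c"
    using assms by (intro tendsto_intros tendsto_neg_powr filterlim_real_sequentially) auto
  moreover have "filterlim (\<lambda>n. exp (q * ln (real n))) at_top sequentially"
    using assms(2) by (intro filterlim_compose[OF exp_at_top]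
      filterlim_tendsto_pos_mult_at_top[OF tendsto_const]
      filterlim_compose[OF ln_at_top filterlim_real_sequentially])
  moreover have "\<forall>\<^sub>F n in sequentially. exp (q * ln (real n)) = real n powr q"
    using eventually_gt_at_top[of 0] by eventually_elim (simp add: powr_def)
  ultimately have "filterlim (\<lambda>n. (M * real n powr - (q - p) - c) * real n powr q) at_bot sequentially"
    using assms by (intro filterlim_tendsto_neg_mult_at_bot[where c = "M * 0 - c"])
      (auto simp: filterlim_cong)
  also have "(\<lambda>n. (M * real n powr - (q - p) - c) * real n powr q) =
      (\<lambda>n. M * real n powr p - c * real n powr q)"
    by (simp add: left_diff_distrib mult.assoc powr_add[symmetric])
  finally show ?thesis
    by (rule filterlim_compose[OF exp_at_bot])
qed

context quasi_metric
begin

lemma uniform_rate_null: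
  assumes \<mu>: "space \<mu> = X" "small_ball_condition X d \<mu> s" and "0 < t" "1 < t * s"
    and A: "controlled_complexity X d A"
    and "x0 \<in> X" and S: "S \<subseteq> qball X d x0 R" and "0 \<le> K"
    and rate: "\<And>n x. 1 \<le> n \<Longrightarrow> x \<in> S \<Longrightarrow> qdist d x (A n) \<le> K * real n powr - t"
  shows "outer_measure_of \<mu> S = 0"
proof -
  obtain L n0 \<eta> where "0 < L" "1 \<le> n0"
    and \<eta>: "\<forall>\<delta>>0. \<exists>M>0. \<forall>n\<ge>1. \<eta> n \<le> M * real n powr (1 + \<delta>)"
    and cover: "\<forall>n\<ge>n0. \<exists>F. finite F \<and> F \<subseteq> X \<and> real (card F) \<le> exp (\<eta> n) \<and>
      S \<subseteq> (\<Union>c\<in>F. qball X d c (L * real n powr - t))"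
    by (rule controlled_cover[OF A \<open>x0 \<in> X\<close> S \<open>0 \<le> K\<close> \<open>0 < t\<close> rate])
  \<comment> \<open>The midpoint serves both ends: p > 1 allows bounding \<open>\<eta> n\<close> by
    a multiple of n^p, and p < t s lets the small-ball decay outweigh the number of balls.\<close>
  define p where "p = (1 + t * s) / 2"
  have p: "1 < p" "p < t * s"
    using \<open>1 < t * s\<close> unfolding p_def by (simp_all add: mult.commute)
  obtain M where "0 < M" and M: "\<And>n. 1 \<le> n \<Longrightarrow> \<eta> n \<le> M * real n powr p"
    using \<eta>[THEN spec, of "p - 1"] p by auto
  obtain c r0 where "0 < c" "0 < r0" and ball: "\<And>x r. x \<in> X \<Longrightarrow> 0 < r \<Longrightarrow> r < r0 \<Longrightarrow>
      outer_measure_of \<mu> (qball X d x r) \<le> ennreal (exp (- c * (1 / r) powr s))"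
    using \<mu>(2) unfolding small_ball_condition_def by blast
  \<comment> \<open>Substituting the radius L n^(-t) into c (1/r)^s gives c' n^(t s).\<close>
  define c' where "c' = c / L powr s"
  have "0 < c'"
    using \<open>0 < c\<close> \<open>0 < L\<close> unfolding c'_def by simp
  have "(\<lambda>n. L * real n powr - t) \<longlonglongrightarrow> L * 0"
    using \<open>0 < t\<close> by (intro tendsto_intros tendsto_neg_powr filterlim_real_sequentially) auto
  then have "\<forall>\<^sub>F n in sequentially. L * real n powr - t < r0"
    using \<open>0 < r0\<close> by (intro order_tendstoD) auto
  then have "\<forall>\<^sub>F n in sequentially.
      outer_measure_of \<mu> S \<le> ennreal (exp (M * real n powr p - c' * real n powr (t * s)))"
    using eventually_ge_at_top[of n0]
  proof eventually_elim
    case (elim n)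
    then have "1 \<le> n"
      using \<open>1 \<le> n0\<close> by simp
    define r where "r = L * real n powr - t"
    have r: "0 < r" "r < r0"
      using \<open>0 < L\<close> \<open>1 \<le> n\<close> elim unfolding r_def by auto
    have "c * (1 / r) powr s = c' * real n powr (t * s)"
      using \<open>0 < L\<close> \<open>1 \<le> n\<close>
      by (simp add: r_def c'_def powr_divide powr_mult powr_powr powr_minus_divide)
    then have ball': "outer_measure_of \<mu> (qball X d x r) \<le> ennreal (exp (- c' * real n powr (t * s)))"
      if "x \<in> X" for x
      using ball[OF that r] by simp
    from cover elim(2) have "\<exists>F. finite F \<and> F \<subseteq> X \<and> real (card F) \<le> exp (\<eta> n) \<and>
        S \<subseteq> (\<Union>c\<in>F. qball X d c r)"
      unfolding r_def by simp
    then obtain F where F: "finite F" "F \<subseteq> X" "real (card F) \<le> exp (\<eta> n)"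
      "S \<subseteq> (\<Union>c\<in>F. qball X d c r)"
      by (elim exE conjE)
    have "outer_measure_of \<mu> S \<le> outer_measure_of \<mu> (\<Union>c\<in>F. qball X d c r)"
      using F(4) by (rule outer_measure_of_mono)
    also have "\<dots> \<le> (\<Sum>c\<in>F. outer_measure_of \<mu> (qball X d c r))"
      using F(1) \<mu>(1) by (intro outer_measure_of_finite_UN_le) (auto simp: qball_def)
    also have "\<dots> \<le> of_nat (card F) * ennreal (exp (- c' * real n powr (t * s)))"
      using F(2) ball' by (intro sum_bounded_above) auto
    also have "\<dots> = ennreal (real (card F) * exp (- c' * real n powr (t * s)))"
      by (simp add: ennreal_mult ennreal_of_nat_eq_real_of_nat)
    also have "real (card F) \<le> exp (M * real n powr p)"
      using F(3) M[OF \<open>1 \<le> n\<close>] by (meson exp_le_cancel_iff order_trans)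
    then have "ennreal (real (card F) * exp (- c' * real n powr (t * s))) \<le>
        ennreal (exp (M * real n powr p) * exp (- c' * real n powr (t * s)))"
      by (intro ennreal_leI mult_right_mono) auto
    also have "\<dots> = ennreal (exp (M * real n powr p - c' * real n powr (t * s)))"
      by (simp add: exp_diff exp_minus divide_inverse)
    finally show ?case .
  qed
  moreover have "(\<lambda>n. ennreal (exp (M * real n powr p - c' * real n powr (t * s)))) \<longlonglongrightarrow> ennreal 0"
    using p \<open>0 < c'\<close> \<open>1 < t * s\<close> by (intro tendsto_ennrealI tendsto_exp_powr_diff) auto
  ultimately have "outer_measure_of \<mu> S \<le> ennreal 0"
    by (intro tendsto_lowerbound) auto
  then show ?thesis
    by simp
qed

lemma approx_rate_set_null:
  assumes \<mu>: "space \<mu> = X" "critical_measure X d S \<mu>"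
    and A: "controlled_complexity X d A"
    and "x0 \<in> X" and S: "S \<subseteq> qball X d x0 R"
    and t: "inverse (lower_exp_minkowski_dim X d S) < ereal t"
  shows "outer_measure_of \<mu> (approx_rate_set d A S t) = 0"
proof -
  have SX: "S \<subseteq> X"
    using S by (auto simp: qball_def)
  have D: "0 \<le> lower_exp_minkowski_dim X d S"
    using dim_nonneg(1)[OF SX] .
  \<comment> \<open>Dimension 0 has reciprocal infinity and admits no real \<open>t\<close>; an
    infinite dimension has reciprocal 0, so t > 0 is all that remains to be shown.\<close>
  have "0 < t \<and> ereal (1 / t) < lower_exp_minkowski_dim X d S"
  proof (cases "lower_exp_minkowski_dim X d S")
    case (real r)
    then have "r \<noteq> 0"
      using t by auto
    then have "0 < r"
      using D real by simp
    then have "1 / r < t" "0 < 1 / r"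
      using t real by (simp_all add: inverse_eq_divide)
    then have "0 < t"
      by (intro less_trans[of 0 "1 / r" t])
    with \<open>1 / r < t\<close> show ?thesis
      using \<open>0 < r\<close> real by (simp add: field_simps)
  next
    case PInf
    then show ?thesis
      using t by simp
  qed (use D in simp)
  then have "0 < t" "ereal (1 / t) < lower_exp_minkowski_dim X d S"
    by simp_all
  then obtain s where s: "1 / t < s" "ereal s < lower_exp_minkowski_dim X d S"
    using ereal_dense2 by (metis ereal_less_eq(3) less_ereal.simps(1))
  then have "0 < s" "1 < t * s"
    using \<open>0 < t\<close> by (auto simp: field_simps intro: less_trans[of 0 "1 / t"])
  then have "small_ball_condition X d \<mu> s"
    using \<mu>(2) s unfolding critical_measure_def by auto
  \<comment> \<open>\<open>uniform_rate_null\<close> needs one constant for the whole set, so the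
    points are sorted by a natural number bounding their individual constants.\<close>
  define T where "T m = {x \<in> S. \<forall>n\<ge>1. qdist d x (A n) \<le> real m * real n powr - t}" for m :: nat
  have T: "T m \<subseteq> space \<mu>" for m
    using SX \<mu>(1) unfolding T_def by auto
  have "outer_measure_of \<mu> (T m) = 0" for m
    using \<mu>(1) \<open>small_ball_condition X d \<mu> s\<close> \<open>0 < t\<close> \<open>1 < t * s\<close> A \<open>x0 \<in> X\<close>
  proof (rule uniform_rate_null[where K = "real m"])
    show "T m \<subseteq> qball X d x0 R"
      using S unfolding T_def by blast
  qed (auto simp: T_def)
  with T have "outer_measure_of \<mu> (\<Union>m. T m) = 0"
    by (rule outer_measure_of_UN_null)
  moreover have "approx_rate_set d A S t \<subseteq> (\<Union>m. T m)"
  proof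
    fix x assume x: "x \<in> approx_rate_set d A S t"
    then have "(SUP n\<in>{1..}. ereal (real n powr t * qdist d x (A n))) \<noteq> \<infinity>"
      unfolding approx_rate_set_def by (metis (mono_tags, lifting) less_irrefl mem_Collect_eq)
    then obtain m :: nat
      where m: "(SUP n\<in>{1..}. ereal (real n powr t * qdist d x (A n))) < ereal (real m)"
      unfolding less_PInf_Ex_of_nat by (elim exE)
    have "qdist d x (A n) \<le> real m * real n powr - t" if "1 \<le> n" for n
    proof -
      have "ereal (real n powr t * qdist d x (A n)) \<le> ereal (real m)"
        using that by (intro order_trans[OF SUP_upper less_imp_le[OF m]]) auto
      then show ?thesis
        using that by (simp add: powr_minus_divide field_simps)
    qed
    then show "x \<in> (\<Union>m. T m)"
      using x by (auto simp: T_def approx_rate_set_def)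
  qed
  ultimately show ?thesis
    using outer_measure_of_mono[of "approx_rate_set d A S t" "\<Union>m. T m" \<mu>] by simp
qed

text \<open>For n >= 1 the power n^s is at most n^t and distances are non-negative. This allows an
  uncountable union over rates to be replaced by a union over rational ones.\<close>

lemma approx_rate_set_antimono:
  assumes "controlled_complexity X d A" "S \<subseteq> X" "s \<le> t"
  shows "approx_rate_set d A S t \<subseteq> approx_rate_set d A S s"
proof
  fix x assume x: "x \<in> approx_rate_set d A S t"
  have "(SUP n\<in>{1..}. ereal (real n powr s * qdist d x (A n))) \<le>
      (SUP n\<in>{1..}. ereal (real n powr t * qdist d x (A n)))"
  proof (intro SUP_mono')
    fix n :: nat
    show "ereal (real n powr s * qdist d x (A n)) \<le> ereal (real n powr t * qdist d x (A n))"
    \<comment> \<open>\<open>SUP_mono'\<close> compares the terms at every natural number; at 0 both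
      powers are 0 by convention.\<close>
    proof (cases "1 \<le> n")
      case True
      then have "0 \<le> qdist d x (A n)"
        using assms x unfolding controlled_complexity_def approx_rate_set_def
        by (intro qdist_nonneg) auto
      then show ?thesis
        using True assms(3) by (auto intro!: mult_right_mono powr_mono)
    qed (simp add: not_le)
  qed
  then show "x \<in> approx_rate_set d A S s"
    using x unfolding approx_rate_set_def by (auto intro: le_less_trans)
qed

end

section \<open>Assembly of the attainment, optimality and null-set statements\<close>

theorem theorem1p13:
  fixes X :: "'a set" and d :: "'a \<Rightarrow> 'a \<Rightarrow> real" and C :: "'a set"
  assumes "quasi_metric_space X d"
    and "C \<noteq> {}" and "C \<subseteq> X" and "qbounded X d C"
  shows
    "(\<exists>A. controlled_complexity X d A \<and>
        (\<forall>t. 0 \<le> t \<and> ereal t < inverse (upper_exp_minkowski_dim X d C) \<longrightarrow>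
           (\<exists>K>0. \<forall>n\<ge>1. (SUP x\<in>C. ereal (qdist d x (A n))) \<le> ereal (K * real n powr (-t)))))
     \<and>
     (\<forall>A t K. controlled_complexity X d A \<and> 0 \<le> t \<and> 0 < K \<and>
        (\<forall>n\<ge>1. (SUP x\<in>C. ereal (qdist d x (A n))) \<le> ereal (K * real n powr (-t)))
        \<longrightarrow> ereal t \<le> inverse (upper_exp_minkowski_dim X d C))
     \<and>
     (\<forall>\<mu>::'a measure. prob_space \<mu> \<and> space \<mu> = X \<and> critical_measure X d C \<mu> \<longrightarrow>
        (\<forall>A. controlled_complexity X d A \<longrightarrow>
           (\<forall>t::real. inverse (lower_exp_minkowski_dim X d C) < ereal t \<longrightarrow>
              outer_measure_of \<mu> (approx_rate_set d A C t) = 0) \<and>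
           outer_measure_of \<mu>
             (\<Union>t\<in>{t::real. inverse (lower_exp_minkowski_dim X d C) < ereal t}.
                approx_rate_set d A C t) = 0))"
proof -
  obtain k where "quasi_metric X d k"
    using assms(1) by (rule quasi_metric_spaceE)
  then interpret quasi_metric X d k .
  obtain x0 R where x0: "x0 \<in> X" "C \<subseteq> qball X d x0 R"
    using assms(4) unfolding qbounded_def by blast
  show ?thesis
  proof (intro conjI allI impI; (elim conjE)?)
    obtain A where A: "controlled_complexity X d A"
      "\<And>t. 0 \<le> t \<Longrightarrow> ereal t < inverse (upper_exp_minkowski_dim X d C) \<Longrightarrow>
         \<exists>K>0. \<forall>n\<ge>1. \<forall>x\<in>C. qdist d x (A n) \<le> K * real n powr - t"
      using optimal_family[OF assms(2) x0] by blast
    have "\<exists>K>0. \<forall>n\<ge>1. (SUP x\<in>C. ereal (qdist d x (A n))) \<le> ereal (K * real n powr (-t))"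
      if "0 \<le> t" "ereal t < inverse (upper_exp_minkowski_dim X d C)" for t
      using A(2)[OF that] by (auto simp: SUP_le_iff)
    then show "\<exists>A. controlled_complexity X d A \<and>
        (\<forall>t. 0 \<le> t \<and> ereal t < inverse (upper_exp_minkowski_dim X d C) \<longrightarrow>
           (\<exists>K>0. \<forall>n\<ge>1. (SUP x\<in>C. ereal (qdist d x (A n))) \<le> ereal (K * real n powr (-t))))"
      using A(1) by blast
  next
    fix A t and K :: real
    assume A: "controlled_complexity X d A" and "0 \<le> t" "0 < K"
      and "\<forall>n\<ge>1. (SUP x\<in>C. ereal (qdist d x (A n))) \<le> ereal (K * real n powr (-t))"
    then have rate: "qdist d x (A n) \<le> K * real n powr - t" if "1 \<le> n" "x \<in> C" for n x
      using that by (auto simp: SUP_le_iff)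
    have D: "0 \<le> upper_exp_minkowski_dim X d C"
      using dim_nonneg(2)[OF assms(3)] .
    show "ereal t \<le> inverse (upper_exp_minkowski_dim X d C)"
    \<comment> \<open>These cases have no usable 1/t or no limit behind the dimension: for t = 0 a
      non-negative reciprocal suffices, and for at most one point the reciprocal of 0 is
      infinity.\<close>
    proof (cases "t = 0 \<or> \<not> (\<exists>x\<in>C. \<exists>y\<in>C. x \<noteq> y)")
      case True
      then show ?thesis
      proof
        assume "t = 0"
        then show ?thesis
          using D by (cases "upper_exp_minkowski_dim X d C") auto
      next
        assume "\<not> (\<exists>x\<in>C. \<exists>y\<in>C. x \<noteq> y)"
        then have "upper_exp_minkowski_dim X d C = 0"
          unfolding upper_exp_minkowski_dim_def by simp
        then show ?thesis
          by simp
      qed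
    next
      case False
      then obtain x y where xy: "x \<in> C" "y \<in> C" "x \<noteq> y" and "0 < t"
        using \<open>0 \<le> t\<close> by auto
      have "upper_exp_minkowski_dim X d C \<le> ereal (1 / t)"
        using upper_dim_le_of_rate[OF A x0 less_imp_le[OF \<open>0 < K\<close>] \<open>0 < t\<close> rate xy] .
      then show ?thesis
        using D \<open>0 < t\<close> by (cases "upper_exp_minkowski_dim X d C") (auto simp: field_simps)
    qed
  next
    fix \<mu> :: "'a measure" and A and t :: real
    assume "space \<mu> = X" "critical_measure X d C \<mu>" "controlled_complexity X d A"
      "inverse (lower_exp_minkowski_dim X d C) < ereal t"
    then show "outer_measure_of \<mu> (approx_rate_set d A C t) = 0"
      using x0 by (intro approx_rate_set_null)
  next
    fix \<mu> :: "'a measure" and A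
    assume \<mu>: "space \<mu> = X" "critical_measure X d C \<mu>" and A: "controlled_complexity X d A"
    let ?T = "{t::real. inverse (lower_exp_minkowski_dim X d C) < ereal t}"
    \<comment> \<open>An enumeration of the rationals; those not above the critical rate contribute
      the empty set.\<close>
    define Q where "Q i = (let q = real_of_rat (from_nat i) in
      if q \<in> ?T then approx_rate_set d A C q else {})" for i
    have "outer_measure_of \<mu> (Q i) = 0" for i
      using approx_rate_set_null[OF \<mu> A x0] unfolding Q_def by (auto simp: Let_def)
    moreover have "Q i \<subseteq> space \<mu>" for i
      using assms(3) \<mu>(1) unfolding Q_def by (auto simp: Let_def approx_rate_set_def)
    ultimately have "outer_measure_of \<mu> (\<Union>i. Q i) = 0"
      by (intro outer_measure_of_UN_null)
    moreover have "(\<Union>t\<in>?T. approx_rate_set d A C t) \<subseteq> (\<Union>i. Q i)"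
    proof
      fix x assume "x \<in> (\<Union>t\<in>?T. approx_rate_set d A C t)"
      then obtain t where t: "t \<in> ?T" "x \<in> approx_rate_set d A C t"
        by blast
      \<comment> \<open>The critical rate is extended real, so a real \<open>r\<close> is inserted
        first, after which density of the rationals in the reals applies.\<close>
      obtain r where r: "inverse (lower_exp_minkowski_dim X d C) < ereal r" "r < t"
        using t(1) ereal_dense2 by (metis less_ereal.simps(1) mem_Collect_eq)
      obtain q where q: "r < real_of_rat q" "real_of_rat q < t"
        using of_rat_dense[OF r(2)] by blast
      then have "real_of_rat q \<in> ?T"
        using r(1) by (auto intro: less_trans)
      moreover have "x \<in> approx_rate_set d A C (real_of_rat q)"
        using approx_rate_set_antimono[OF A assms(3)] q(2) t(2) by (meson less_imp_le subsetD)
      ultimately have "x \<in> Q (to_nat q)"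
        unfolding Q_def by (simp add: Let_def)
      then show "x \<in> (\<Union>i. Q i)"
        by blast
    qed
    ultimately show "outer_measure_of \<mu> (\<Union>t\<in>?T. approx_rate_set d A C t) = 0"
      using outer_measure_of_mono[of _ "\<Union>i. Q i" \<mu>] by (metis le_zero_eq)
  qed
qed

end
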